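(* For any $\alpha=o(\sqrt{n/\log n})$ and $m=\mathrm{poly}(n)$, any deterministic single-pass streaming algorithm that $\alpha$-estimates the set cover problem (on instances of $m$ subsets of $[n]$ arriving in a stream) requires $\Omega(mn/\alpha)$ bits of space.
   Context: For a collection of subsets of $[n]$, $\mathrm{opt}$ is the minimum number of the sets whose union is $[n]$. An algorithm $\alpha$-estimates set cover if on every input it outputs a value in $[\mathrm{opt},\alpha\cdot\mathrm{opt}]$. In the streaming model the sets arrive one at a time in arbitrary order and a single-pass algorithm reads the stream once.
   Formalization: Here m = poly(n) means m = O(n^k) and, in addition, m > 2α is assumed for all large n; without it the claim fails, since for m ≤ 2α the one-bit algorithm that outputs 1 if some set is [n] and m otherwise is a correct α-estimator. *)

theory Defs
  imports Complex_Main "HOL-Library.Landau_Symbols"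
begin

text \<open>The ground set \<open>[n]\<close> is \<open>{1..n}\<close>. An input is a sequence of subsets of \<open>[n]\<close> in order of
  arrival; it is required to cover \<open>[n]\<close>, since otherwise the optimum is undefined.\<close>

definition set_cover_streams :: "nat \<Rightarrow> nat \<Rightarrow> nat set list set" where
  "set_cover_streams n m =
     {Ss. length Ss = m \<and> (\<forall>S \<in> set Ss. S \<subseteq> {1..n}) \<and> \<Union> (set Ss) = {1..n}}"

definition opt :: "nat \<Rightarrow> nat set set \<Rightarrow> nat" where
  "opt n \<S> = Min (card ` {\<C>. \<C> \<subseteq> \<S> \<and> \<Union> \<C> = {1..n}})"

text \<open>A deterministic single-pass algorithm for fixed (known) \<open>n\<close> and \<open>m\<close>. Only the memory contents
  between arrivals are modelled and charged for; update and result are arbitrary functions,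
  so neither computation time nor working memory within one step is restricted.\<close>

record stream_alg =
  init :: "bool list"
  update :: "bool list \<Rightarrow> nat set \<Rightarrow> bool list"
  result :: "bool list \<Rightarrow> real"

definition memory_after :: "stream_alg \<Rightarrow> nat set list \<Rightarrow> bool list" where
  "memory_after A Ss = foldl (update A) (init A) Ss"

definition estimates_set_cover :: "stream_alg \<Rightarrow> real \<Rightarrow> nat \<Rightarrow> nat \<Rightarrow> bool" where
  "estimates_set_cover A \<alpha> n m \<longleftrightarrow>
     (\<forall>Ss \<in> set_cover_streams n m.
        result A (memory_after A Ss) \<in> {real (opt n (set Ss)) .. \<alpha> * real (opt n (set Ss))})"

text \<open>Worst-case number of bits stored, over all inputs and all points of time in the stream.\<close>

definition space :: "stream_alg \<Rightarrow> nat \<Rightarrow> nat \<Rightarrow> nat" where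
  "space A n m =
     Max {length (memory_after A (take i Ss)) | Ss i. Ss \<in> set_cover_streams n m \<and> i \<le> m}"

end

theory Submission
  imports Defs "HOL-Library.FuncSet"
begin

text \<open>The prefixes of a stream form a large fooling set. Each prefix is a list of \<open>t\<close> sets, all
  containing the point 1; the \<open>i\<close>-th set is otherwise the graph of \<open>x \<mapsto> (f\<^sub>i x, g x)\<close>. The \<open>f\<^sub>i\<close>
  are fixed and any two agree on fewer than \<open>b\<close> arguments, so that sets in different positions meet
  in at most \<open>b\<close> points; \<open>g\<close> ranges, independently in each position, over an exponentially large
  code whose words differ on at least half of the arguments.

  If two prefixes differ in position \<open>i\<close>, with sets \<open>S\<close> and \<open>S'\<close>, the suffix offers a set \<open>T\<close> that
  completes \<open>S\<close> to a cover of size 2 but misses 1 and \<open>b k\<close> points of \<open>S - S'\<close>, together with these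
  points cut into \<open>k\<close> blocks of size \<open>b\<close>. With the second prefix every available set then
  contains at most \<open>b\<close> of the missed points, so more than \<open>2 \<alpha>\<close> sets are needed when \<open>k \<ge> 2 \<alpha>\<close>.
  Hence different prefixes lead to different memory contents. The condition on \<open>\<alpha>\<close> gives
  \<open>b\<close>, of order \<open>n / \<alpha>\<^sup>2\<close>, the room needed for polynomially many \<open>f\<^sub>i\<close>.

  When \<open>m\<close> is within a constant factor of \<open>\<alpha>\<close>, there may be no room for both \<open>t\<close> of order \<open>m\<close> and
  \<open>k\<close> of order \<open>\<alpha>\<close>; a single set in the prefix then suffices, with singleton blocks, since only
  order \<open>n\<close> bits are required.\<close>

section \<open>Codes of words with small pairwise agreement\<close>

definition agreement :: "nat \<Rightarrow> (nat \<Rightarrow> nat) \<Rightarrow> (nat \<Rightarrow> nat) \<Rightarrow> nat" where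
  "agreement L f g = card {x. x < L \<and> f x = g x}"

lemma agreement_self [simp]: "agreement L f f = L"
  by (simp add: agreement_def)

lemma agreement_commute: "agreement L f g = agreement L g f"
  unfolding agreement_def by metis

text \<open>The quotient \<open>a ^ a / fact a\<close> is a single term of the exponential series at
  \<open>a\<close>, and \<open>exp 1 <= 3\<close>.\<close>

lemma power_self_le_fact: "a ^ a \<le> 3 ^ a * (fact a :: nat)"
proof -
  have "real a ^ a / fact a \<le> exp (real a)"
  proof -
    have s: "summable (\<lambda>n. inverse (fact n) * real a ^ n)"
      using summable_exp[of "real a"] by simp
    have "sum (\<lambda>n. inverse (fact n) * real a ^ n) {a} \<le> (\<Sum>n. inverse (fact n) * real a ^ n)"
      by (rule sum_le_suminf[OF s]) auto
    then show ?thesis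
      by (simp add: exp_def field_simps)
  qed
  also have "exp (real a) = exp 1 ^ a"
    by (simp add: exp_of_nat_mult[symmetric])
  also have "\<dots> \<le> 3 ^ a"
    using exp_le by (intro power_mono) auto
  finally have "real (a ^ a) \<le> real (3 ^ a * fact a)"
    by (simp add: field_simps)
  then show ?thesis
    using of_nat_le_iff by blast
qed

text \<open>For positive \<open>a\<close> the factorial bound gives
  \<open>(L choose a) <= (3 * L / a) ^ a\<close>, and the factor \<open>2 ^ a\<close> turns the 3
  into 6. Multiplying through by \<open>a ^ a\<close> keeps the argument in the naturals.\<close>

lemma two_power_binomial_le:
  fixes L q a :: nat
  assumes "6 * L \<le> a * q"
  shows "2 ^ a * (L choose a) \<le> q ^ a"
proof (cases "a = 0")
  case False
  have "a ^ a * (2 ^ a * (L choose a)) \<le> 3 ^ a * fact a * (2 ^ a * (L choose a))"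
    by (intro mult_right_mono power_self_le_fact) auto
  also have "\<dots> = 6 ^ a * (fact a * (L choose a))"
    by (simp add: power_mult_distrib[symmetric] ac_simps flip: mult.assoc)
  also have "\<dots> \<le> 6 ^ a * L ^ a"
  proof (cases "a \<le> L")
    case True
    have "(L choose a) * fact a \<le> L ^ a"
      by (metis binomial_fact_pow mult.commute)
    then show ?thesis
      by (simp add: mult.commute)
  qed (simp add: binomial_eq_0)
  also have "\<dots> = (6 * L) ^ a"
    by (simp add: power_mult_distrib)
  also have "\<dots> \<le> (a * q) ^ a"
    using assms by (intro power_mono) auto
  also have "\<dots> = a ^ a * q ^ a"
    by (simp add: power_mult_distrib)
  finally show ?thesis
    using False by simp
qed auto

text \<open>Union bound over the \<open>a\<close>-element sets \<open>D\<close> of positions where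
  \<open>g\<close> copies \<open>f\<close>; the other \<open>L - a\<close> letters are free.\<close>

lemma card_agreement_ball_le:
  assumes f: "f \<in> {..<L} \<rightarrow>\<^sub>E {..<q}" and "a \<le> L"
  shows "card {g \<in> {..<L} \<rightarrow>\<^sub>E {..<q}. a \<le> agreement L f g} \<le> (L choose a) * q ^ (L - a)"
proof -
  define \<D> where "\<D> = {D. D \<subseteq> {..<L} \<and> card D = a}"
  define C where "C D = (\<Pi>\<^sub>E x\<in>{..<L}. if x \<in> D then {f x} else {..<q})" for D
  have finD: "finite \<D>" by (simp add: \<D>_def)
  have finC: "finite (C D)" for D
    unfolding C_def by (intro finite_PiE) auto
  have cardC: "card (C D) = q ^ (L - a)" if "D \<in> \<D>" for D
  proof -
    have D: "D \<subseteq> {..<L}" "card D = a" using that by (auto simp: \<D>_def)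
    have "card (C D) = (\<Prod>x<L. if x \<in> D then 1 else q)"
      unfolding C_def by (subst card_PiE) (auto intro!: prod.cong)
    also have "\<dots> = q ^ card ({..<L} - D)"
      by (simp add: prod.If_cases Diff_eq)
    also have "card ({..<L} - D) = L - a"
      using D by (simp add: card_Diff_subset finite_subset)
    finally show ?thesis .
  qed
  have "{g \<in> {..<L} \<rightarrow>\<^sub>E {..<q}. a \<le> agreement L f g} \<subseteq> (\<Union>D\<in>\<D>. C D)"
  proof
    fix g assume g: "g \<in> {g \<in> {..<L} \<rightarrow>\<^sub>E {..<q}. a \<le> agreement L f g}"
    then obtain D where D: "D \<subseteq> {x. x < L \<and> f x = g x}" "card D = a"
      unfolding agreement_def by (metis (lifting) mem_Collect_eq obtain_subset_with_card_n)
    have "D \<in> \<D>" using D by (auto simp: \<D>_def)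
    moreover have "g \<in> C D"
      using g D by (auto simp: C_def PiE_iff)
    ultimately show "g \<in> (\<Union>D\<in>\<D>. C D)" by blast
  qed
  then have "card {g \<in> {..<L} \<rightarrow>\<^sub>E {..<q}. a \<le> agreement L f g} \<le> card (\<Union>D\<in>\<D>. C D)"
    using finD finC by (intro card_mono) auto
  also have "\<dots> \<le> (\<Sum>D\<in>\<D>. card (C D))"
    by (rule card_UN_le[OF finD])
  also have "\<dots> = card \<D> * q ^ (L - a)"
    by (simp add: cardC)
  also have "card \<D> = (L choose a)"
    by (simp add: \<D>_def n_subsets)
  finally show ?thesis .
qed

text \<open>The Gilbert--Varshamov bound: as long as there are fewer than \<open>2 ^ a\<close> codewords, the balls
  around them do not exhaust all words.\<close>

lemma code_exists:
  fixes L q a N :: nat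
  assumes "6 * L \<le> a * q" "0 < a" "a \<le> L" "N \<le> 2 ^ a"
  shows "\<exists>F. F \<subseteq> {..<L} \<rightarrow>\<^sub>E {..<q} \<and> card F = N \<and> finite F \<and>
           (\<forall>f\<in>F. \<forall>g\<in>F. f \<noteq> g \<longrightarrow> agreement L f g < a)"
  using assms(4)
proof (induction N)
  case 0
  show ?case by (intro exI[of _ "{}"]) auto
next
  case (Suc N)
  let ?P = "{..<L} \<rightarrow>\<^sub>E {..<q}"
  from Suc obtain F where F: "F \<subseteq> ?P" "card F = N" "finite F"
    "\<And>f g. f \<in> F \<Longrightarrow> g \<in> F \<Longrightarrow> f \<noteq> g \<Longrightarrow> agreement L f g < a"
    by auto
  have "0 < q" using assms by (cases q) auto
  define U where "U = (\<Union>f\<in>F. {g \<in> ?P. a \<le> agreement L f g})"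
  have "card U \<le> (\<Sum>f\<in>F. card {g \<in> ?P. a \<le> agreement L f g})"
    unfolding U_def by (rule card_UN_le[OF F(3)])
  also have "\<dots> \<le> (\<Sum>f\<in>F. (L choose a) * q ^ (L - a))"
    using F(1) assms(3) by (intro sum_mono card_agreement_ball_le) auto
  also have "\<dots> = N * ((L choose a) * q ^ (L - a))"
    by (simp add: F(2))
  also have "\<dots> < 2 ^ a * ((L choose a) * q ^ (L - a))"
    using Suc.prems \<open>0 < q\<close> assms(3) by (intro mult_strict_right_mono) auto
  also have "\<dots> = (2 ^ a * (L choose a)) * q ^ (L - a)"
    by simp
  also have "\<dots> \<le> q ^ a * q ^ (L - a)"
    by (intro mult_right_mono two_power_binomial_le assms) auto
  also have "\<dots> = card ?P"
    using assms(3) by (simp add: card_PiE flip: power_add)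
  finally have "card U < card ?P" .
  moreover have "U \<subseteq> ?P" by (auto simp: U_def)
  ultimately have "U \<noteq> ?P" "U \<subseteq> ?P" by auto
  then obtain h where h: "h \<in> ?P" "h \<notin> U"
    by blast
  then have hF: "agreement L f h < a" if "f \<in> F" for f
    using that by (auto simp: U_def not_le)
  \<comment> \<open>A codeword agrees with itself in \<open>L >= a\<close> places, so
    \<open>h\<close> is new.\<close>
  with assms(3) have "h \<notin> F" by fastforce
  show ?case
    by (rule exI[of _ "insert h F"])
      (use F h hF \<open>h \<notin> F\<close> in \<open>auto simp: agreement_commute[of L h]\<close>)
qed

section \<open>Optimal covers, memory contents and fooling sets\<close>

lemma finite_set_cover_streams: "finite (set_cover_streams n m)"
proof (rule finite_subset)
  show "set_cover_streams n m \<subseteq> {Ss. set Ss \<subseteq> Pow {1..n} \<and> length Ss = m}"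
    by (auto simp: set_cover_streams_def)
qed (simp add: finite_lists_length_eq)

lemma opt_le:
  assumes "finite \<S>" "\<C> \<subseteq> \<S>" "\<Union>\<C> = {1..n}"
  shows "opt n \<S> \<le> card \<C>"
  unfolding opt_def using assms by (intro Min_le) auto

text \<open>Each member of an optimal cover accounts for at most \<open>b\<close> points of
  \<open>W\<close>. This supplies the lower bound on the optimum of the second stream.\<close>

lemma card_le_mult_opt:
  assumes "finite \<S>" "\<Union>\<S> = {1..n}" "W \<subseteq> {1..n}"
    and meet: "\<And>S. S \<in> \<S> \<Longrightarrow> card (S \<inter> W) \<le> b"
  shows "card W \<le> b * opt n \<S>"
proof -
  let ?M = "card ` {\<C>. \<C> \<subseteq> \<S> \<and> \<Union>\<C> = {1..n}}"
  have "opt n \<S> \<in> ?M"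
    unfolding opt_def using assms(1,2) by (intro Min_in) auto
  then obtain \<C> where \<C>: "\<C> \<subseteq> \<S>" "\<Union>\<C> = {1..n}" "opt n \<S> = card \<C>"
    by auto
  have "finite \<C>" using \<C>(1) assms(1) finite_subset by blast
  have "W = (\<Union>S\<in>\<C>. S \<inter> W)" using \<C>(2) assms(3) by auto
  then have "card W \<le> (\<Sum>S\<in>\<C>. card (S \<inter> W))"
    using card_UN_le[OF \<open>finite \<C>\<close>, of "\<lambda>S. S \<inter> W"] by simp
  also have "\<dots> \<le> (\<Sum>S\<in>\<C>. b)"
    using \<C>(1) meet by (intro sum_mono) auto
  finally show ?thesis by (simp add: \<C>(3) mult.commute)
qed

lemma length_memory_le_space:
  assumes "Ss \<in> set_cover_streams n m" "i \<le> m"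
  shows "length (memory_after A (take i Ss)) \<le> space A n m"
  unfolding space_def
proof (rule Max_ge)
  have "{length (memory_after A (take i Ss)) | Ss i. Ss \<in> set_cover_streams n m \<and> i \<le> m}
     = (\<lambda>(Ss, i). length (memory_after A (take i Ss))) ` (set_cover_streams n m \<times> {..m})"
    by auto
  then show "finite {length (memory_after A (take i Ss)) | Ss i. Ss \<in> set_cover_streams n m \<and> i \<le> m}"
    by (simp add: finite_set_cover_streams)
qed (use assms in blast)

lemma memory_after_append: "memory_after A (X @ B) = foldl (update A) (memory_after A X) B"
  by (simp add: memory_after_def)

text \<open>Two prefixes with the same memory contents receive the same estimate after the same suffix.\<close>

lemma card_fooling_set_less:
  assumes est: "estimates_set_cover A \<alpha> n m"
    and ext: "\<And>X. X \<in> \<F> \<Longrightarrow> \<exists>B. X @ B \<in> set_cover_streams n m"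
    and fool: "\<And>X Y. X \<in> \<F> \<Longrightarrow> Y \<in> \<F> \<Longrightarrow> X \<noteq> Y \<Longrightarrow>
      \<exists>B. X @ B \<in> set_cover_streams n m \<and> Y @ B \<in> set_cover_streams n m \<and>
          \<alpha> * real (opt n (set (X @ B))) < real (opt n (set (Y @ B)))"
  shows "card \<F> < 2 ^ (space A n m + 1)"
proof -
  let ?s = "space A n m"
  have "inj_on (memory_after A) \<F>"
  proof (rule inj_onI, rule ccontr)
    fix X Y assume XY: "X \<in> \<F>" "Y \<in> \<F>" "memory_after A X = memory_after A Y" "X \<noteq> Y"
    then obtain B where B: "X @ B \<in> set_cover_streams n m" "Y @ B \<in> set_cover_streams n m"
      "\<alpha> * real (opt n (set (X @ B))) < real (opt n (set (Y @ B)))"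
      using fool by blast
    have "memory_after A (X @ B) = memory_after A (Y @ B)"
      using XY(3) by (simp add: memory_after_append)
    moreover have "real (opt n (set (Y @ B))) \<le> result A (memory_after A (Y @ B))"
      "result A (memory_after A (X @ B)) \<le> \<alpha> * real (opt n (set (X @ B)))"
      using est B(1,2) unfolding estimates_set_cover_def atLeastAtMost_iff by blast+
    ultimately show False
      using B(3) by simp
  qed
  moreover have "memory_after A ` \<F> \<subseteq> {xs. set xs \<subseteq> UNIV \<and> length xs \<le> ?s}"
  \<comment> \<open>\<open>space\<close> looks only at prefixes of covering streams, so
    \<open>ext\<close> must first extend the prefix to one.\<close>
  proof clarsimp
    fix X assume "X \<in> \<F>"
    then obtain B where B: "X @ B \<in> set_cover_streams n m" using ext by blast
    then have "length X \<le> m" by (auto simp: set_cover_streams_def)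
    from length_memory_le_space[OF B this, of A]
    show "length (memory_after A X) \<le> ?s" by simp
  qed
  ultimately have "card \<F> \<le> card {xs :: bool list. set xs \<subseteq> UNIV \<and> length xs \<le> ?s}"
    by (intro card_inj_on_le[of "memory_after A"] finite_lists_length_le) auto
  also have "\<dots> = (\<Sum>i\<le>?s. 2 ^ i)"
    by (subst card_lists_length_le) auto
  also have "\<dots> < 2 ^ (?s + 1)"
    using sum_power2[of "Suc ?s"] unfolding atLeast0LessThan lessThan_Suc_atMost by simp
  finally show ?thesis .
qed

section \<open>The hard streams\<close>

lemma partition_into_blocks:
  assumes "finite W" "card W = b * k"
  shows "\<exists>Ps. length Ps = k \<and> \<Union>(set Ps) = W \<and> (\<forall>P\<in>set Ps. card P = b)"
  using assms
proof (induction k arbitrary: W)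
  case 0
  then show ?case by (intro exI[of _ "[]"]) auto
next
  case (Suc k)
  then obtain P where P: "P \<subseteq> W" "card P = b" "finite P"
    by (metis obtain_subset_with_card_n le_add1 mult_Suc_right)
  have "card (W - P) = b * k"
    using Suc.prems P by (simp add: card_Diff_subset)
  with Suc obtain Ps where "length Ps = k" "\<Union>(set Ps) = W - P" "\<forall>P\<in>set Ps. card P = b"
    by (metis finite_Diff)
  with P show ?case by (intro exI[of _ "P # Ps"]) auto
qed


text \<open>The fooling argument for an abstract family \<open>S i g\<close> with position
  \<open>i\<close> and label \<open>g\<close>. Here \<open>inter\<close> limits what other positions
  can cover, \<open>diff\<close> supplies the points to be missed, \<open>len\<close> counts
  \<open>t\<close> prefix sets, the set \<open>T\<close> and \<open>k\<close> blocks, and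
  \<open>gap\<close> makes the \<open>b * k + 2\<close> points of \<open>W\<close> too many for
  \<open>2 * \<alpha>\<close> sets.\<close>

lemma card_power_less_space:
  fixes S :: "nat \<Rightarrow> 'g \<Rightarrow> nat set" and \<alpha> :: real
  assumes est: "estimates_set_cover A \<alpha> n m" and "0 \<le> \<alpha>" and "finite G"
    and sub: "\<And>i g. i < t \<Longrightarrow> g \<in> G \<Longrightarrow> S i g \<subseteq> {1..n}"
    and p: "p \<in> {1..n}" "\<And>i g. i < t \<Longrightarrow> g \<in> G \<Longrightarrow> p \<in> S i g"
    and inter: "\<And>i j g h. i < t \<Longrightarrow> j < t \<Longrightarrow> i \<noteq> j \<Longrightarrow> g \<in> G \<Longrightarrow> h \<in> G \<Longrightarrow>
                  card (S i g \<inter> S j h) \<le> b"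
    and diff: "\<And>i g h. i < t \<Longrightarrow> g \<in> G \<Longrightarrow> h \<in> G \<Longrightarrow> g \<noteq> h \<Longrightarrow>
                  b * k + 1 \<le> card (S i g - S i h)"
    and len: "t + 1 + k \<le> m" and "1 \<le> b" and gap: "2 * \<alpha> * real b < real (b * k + 2)"
  shows "card G ^ t < 2 ^ (space A n m + 1)"
proof -
  define sets where "sets x = map (\<lambda>i. S i (x i)) [0..<t]" for x
  define I where "I = {..<t} \<rightarrow>\<^sub>E G"
  have finS: "finite (S i g)" if "i < t" "g \<in> G" for i g
    using sub[OF that] finite_subset by blast
  have set_sets: "set (sets x) = (\<lambda>i. S i (x i)) ` {..<t}" for x
    by (auto simp: sets_def)
  have G: "x i \<in> G" if "x \<in> I" "i < t" for x i
    using that by (auto simp: I_def)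
  have sub_sets: "R \<subseteq> {1..n}" if "x \<in> I" "R \<in> set (sets x)" for x R
    using that sub G by (fastforce simp: set_sets)
  have neq: "\<exists>i<t. x i \<noteq> y i" if "x \<in> I" "y \<in> I" "x \<noteq> y" for x y
    using that unfolding I_def by (metis PiE_ext lessThan_iff)
  have inj: "inj_on sets I"
  proof (rule inj_onI, rule ccontr)
    fix x y assume xy: "x \<in> I" "y \<in> I" "sets x = sets y" "x \<noteq> y"
    then obtain i where i: "i < t" "x i \<noteq> y i" using neq by blast
    then have "S i (x i) = S i (y i)"
      using xy(3) by (simp add: sets_def list_eq_iff_nth_eq)
    with diff[OF i(1) G[OF xy(1) i(1)] G[OF xy(2) i(1)] i(2)] show False by simp
  qed
  have "card (sets ` I) < 2 ^ (space A n m + 1)"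
  proof (rule card_fooling_set_less[OF est])
    fix X assume "X \<in> sets ` I"
    then obtain x where x: "x \<in> I" "X = sets x" by auto
    \<comment> \<open>The ground set completes any prefix; empty sets pad the stream to length
      \<open>m\<close>.\<close>
    have "X @ {1..n} # replicate (m - t - 1) {} \<in> set_cover_streams n m"
      using sub_sets[OF x(1)] x(2) len
      by (auto simp: set_cover_streams_def sets_def[of x])
    then show "\<exists>B. X @ B \<in> set_cover_streams n m" by blast
  next
    fix X Y assume "X \<in> sets ` I" "Y \<in> sets ` I" "X \<noteq> Y"
    then obtain x y where xy: "x \<in> I" "X = sets x" "y \<in> I" "Y = sets y" "x \<noteq> y" by auto
    then obtain i where i: "i < t" "x i \<noteq> y i" using neq by blast
    define g h where "g = x i" and "h = y i"
    have gh: "g \<in> G" "h \<in> G" "g \<noteq> h"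
      using G xy i by (auto simp: g_def h_def)
    obtain E where E: "E \<subseteq> S i g - S i h" "card E = b * k + 1" "finite E"
      using diff[OF i(1) gh] by (metis obtain_subset_with_card_n)
    then obtain r where r: "r \<in> E" by fastforce
    \<comment> \<open>\<open>r\<close> makes \<open>T\<close> indispensable, and \<open>p\<close> some set of the prefix; this matters when \<open>m\<close> is
        barely above \<open>2 \<alpha>\<close>.\<close>
    define W where "W = insert p E"
    have "p \<notin> E" using E p(2) i(1) gh(2) by auto
    have EW: "E \<subseteq> {1..n}" "W \<subseteq> {1..n}"
      using E sub[OF i(1) gh(1)] p(1) by (auto simp: W_def)
    have "card (E - {r}) = b * k" using E r by simp
    then obtain Ps where Ps: "length Ps = k" "\<Union>(set Ps) = E - {r}" "\<forall>P\<in>set Ps. card P = b"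
      using partition_into_blocks[of "E - {r}" b k] E(3) by auto
    define T where "T = {1..n} - insert p (E - {r})"
    define B where "B = T # Ps @ replicate (m - t - 1 - k) {}"
    have setB: "set B \<subseteq> insert T (insert {} (set Ps))" "T \<in> set B" "set Ps \<subseteq> set B"
      by (auto simp: B_def)
    have subB: "R \<subseteq> {1..n}" if "R \<in> set B" for R
    proof -
      have "R \<in> insert T (insert {} (set Ps))" using that setB(1) by blast
      then consider "R = T" | "R = {}" | "R \<in> set Ps" by blast
      then show ?thesis
      proof cases
        case 3
        then have "R \<subseteq> E - {r}" using Ps(2) by auto
        with EW(1) show ?thesis by auto
      qed (auto simp: T_def)
    qed
    have lenB: "length (sets z @ B) = m" for z
      using len Ps(1) by (simp add: sets_def B_def)
    have Sx: "S i g \<in> set (sets x)" and Sy: "S i h \<in> set (sets y)"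
      using i(1) by (auto simp: set_sets g_def h_def)
    have unX: "\<Union>{S i g, T} = {1..n}"
      using sub[OF i(1) gh(1)] E(1) p(2)[OF i(1) gh(1)] by (auto simp: T_def)
    have "\<Union>(set (X @ B)) = {1..n}"
    proof
      show "\<Union>(set (X @ B)) \<subseteq> {1..n}" using subB sub_sets xy by fastforce
      have "\<Union>{S i g, T} \<subseteq> \<Union>(set (X @ B))" using Sx setB xy by auto
      then show "{1..n} \<subseteq> \<Union>(set (X @ B))" unfolding unX .
    qed
    then have XB: "X @ B \<in> set_cover_streams n m"
      unfolding set_cover_streams_def using lenB subB sub_sets xy by fastforce
    have unY: "\<Union>(set (Y @ B)) = {1..n}"
    proof
      show "\<Union>(set (Y @ B)) \<subseteq> {1..n}" using subB sub_sets xy by fastforce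
      have "S i h \<union> T \<union> \<Union>(set Ps) \<subseteq> \<Union>(set (Y @ B))" using Sy setB xy by auto
      \<comment> \<open>Of the points that \<open>T\<close> omits, \<open>p\<close> lies in
        \<open>S i h\<close> and the others in the blocks.\<close>
      moreover have "{1..n} \<subseteq> S i h \<union> T \<union> \<Union>(set Ps)"
        using p(2)[OF i(1) gh(2)] unfolding Ps(2) T_def by auto
      ultimately show "{1..n} \<subseteq> \<Union>(set (Y @ B))" by blast
    qed
    then have YB: "Y @ B \<in> set_cover_streams n m"
      unfolding set_cover_streams_def using lenB subB sub_sets xy by fastforce
    have "opt n (set (X @ B)) \<le> card {S i g, T}"
      using Sx setB xy unX by (intro opt_le) auto
    also have "\<dots> \<le> 2" by (simp add: card_insert_le_m1)
    finally have optX: "opt n (set (X @ B)) \<le> 2" .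
    \<comment> \<open>Within \<open>W\<close>, position \<open>i\<close> of the second prefix
      reaches only \<open>p\<close>, and \<open>T\<close> only \<open>r\<close>. Other positions are
      bounded by \<open>inter\<close>, as \<open>W\<close> lies inside \<open>S i g\<close>; blocks
      have size \<open>b\<close>.\<close>
    have "card W \<le> b * opt n (set (Y @ B))"
    proof (rule card_le_mult_opt[OF _ unY EW(2)])
      fix R assume "R \<in> set (Y @ B)"
      then consider j where "j < t" "R = S j (y j)" | "R = T" | "R = {}" | "R \<in> set Ps"
        using setB(1) xy(4) by (auto simp: set_sets)
      then show "card (R \<inter> W) \<le> b"
      proof cases
        case (1 j)
        show ?thesis
        proof (cases "j = i")
          case True
          then have "R \<inter> W \<subseteq> {p}" using 1 E(1) by (auto simp: W_def h_def)
          from card_mono[OF _ this] \<open>1 \<le> b\<close> show ?thesis by simp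
        next
          case False
          have "card (R \<inter> W) \<le> card (S i g \<inter> S j (y j))"
            using 1 E(1) p(2)[OF i(1) gh(1)] finS[OF i(1) gh(1)]
            by (intro card_mono) (auto simp: W_def)
          also have "\<dots> \<le> b"
            using 1 False i(1) gh(1) xy(3) G by (intro inter) auto
          finally show ?thesis .
        qed
      next
        case 2
        then have "R \<inter> W \<subseteq> {r}" by (auto simp: W_def T_def)
        from card_mono[OF _ this] \<open>1 \<le> b\<close> show ?thesis by simp
      next
        case 4
        then have "finite R" "card R = b"
          using Ps E(3) by (auto intro: finite_subset[of R "E - {r}"])
        then show ?thesis
          using card_mono[of R "R \<inter> W"] by simp
      qed simp
    qed simp
    moreover have "card W = b * k + 2"
      using \<open>p \<notin> E\<close> E by (simp add: W_def)
    ultimately have "real (b * k + 2) \<le> real b * real (opt n (set (Y @ B)))"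
      by (metis of_nat_le_iff of_nat_mult)
    with gap have "real b * (2 * \<alpha>) < real b * real (opt n (set (Y @ B)))"
      by (simp add: mult.commute)
    then have "2 * \<alpha> < real (opt n (set (Y @ B)))"
      using \<open>1 \<le> b\<close> by simp
    moreover have "\<alpha> * real (opt n (set (X @ B))) \<le> \<alpha> * 2"
      using optX \<open>0 \<le> \<alpha>\<close> by (intro mult_left_mono) auto
    ultimately show "\<exists>B. X @ B \<in> set_cover_streams n m \<and> Y @ B \<in> set_cover_streams n m \<and>
        \<alpha> * real (opt n (set (X @ B))) < real (opt n (set (Y @ B)))"
      using XB YB by (intro exI[of _ B]) auto
  qed
  moreover have "card (sets ` I) = card G ^ t"
    using inj by (simp add: card_image I_def card_PiE)
  ultimately show ?thesis by simp
qed

text \<open>Realises the abstract family by graphs of \<open>(f i, g)\<close>. The code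
  \<open>G\<close> has \<open>2 ^ L\<close> words, so \<open>card G ^ t\<close> contributes
  \<open>t * L\<close> bits.\<close>

lemma mult_le_space:
  fixes f :: "nat \<Rightarrow> nat \<Rightarrow> nat" and \<alpha> :: real and L q :: nat
  assumes est: "estimates_set_cover A \<alpha> n m" and "0 \<le> \<alpha>"
    and f: "\<And>i x. i < t \<Longrightarrow> x < 2 * L \<Longrightarrow> f i x < q"
    and agree: "\<And>i j. i < t \<Longrightarrow> j < t \<Longrightarrow> i \<noteq> j \<Longrightarrow> agreement (2 * L) (f i) (f j) < b"
    and "0 < L" "b * k \<le> L" "24 * L * q < n"
    and len: "t + 1 + k \<le> m" and "1 \<le> b" and gap: "2 * \<alpha> * real b < real (b * k + 2)"
  shows "t * L \<le> space A n m"
proof -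
  \<comment> \<open>Alphabet size 12 meets \<open>6 * (2 * L) <= L * 12\<close> with
    equality.\<close>
  obtain G where G: "G \<subseteq> {..<2 * L} \<rightarrow>\<^sub>E {..<12}" "card G = 2 ^ L" "finite G"
    "\<And>g h. g \<in> G \<Longrightarrow> h \<in> G \<Longrightarrow> g \<noteq> h \<Longrightarrow> agreement (2 * L) g h < L"
    using code_exists[of "2 * L" L 12 "2 ^ L"] \<open>0 < L\<close> by auto
  \<comment> \<open>The \<open>24 * L * q\<close> triples fit into \<open>{2..n}\<close>; the point
    1 is reserved as the common point.\<close>
  define D where "D = {..<2 * L} \<times> {..<q} \<times> {..<12::nat}"
  have "card D \<le> card {2..n}"
    using \<open>24 * L * q < n\<close> by (simp add: D_def)
  then obtain e where e: "inj_on e D" "e ` D \<subseteq> {2..n}"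
    using card_le_inj[of D "{2..n}"] by (auto simp: D_def)
  define S where "S i g = insert 1 ((\<lambda>x. e (x, f i x, g x)) ` {..<2 * L})" for i g
  have inD: "(x, f i x, g x) \<in> D" if "i < t" "g \<in> G" "x < 2 * L" for i g x
    using that f G(1) by (auto simp: D_def)
  have e2: "e (x, f i x, g x) \<in> {2..n}" if "i < t" "g \<in> G" "x < 2 * L" for i g x
    using e(2) inD[OF that] by blast
  have eq: "x = y \<and> f i x = f j y \<and> g x = h y"
    if "e (x, f i x, g x) = e (y, f j y, h y)" "i < t" "j < t" "g \<in> G" "h \<in> G" "x < 2 * L" "y < 2 * L"
    for i j g h x y
    using inj_onD[OF e(1) that(1) inD[OF that(2,4,6)] inD[OF that(3,5,7)]] by auto
  have "card G ^ t < 2 ^ (space A n m + 1)"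
  proof (rule card_power_less_space[OF est \<open>0 \<le> \<alpha>\<close> G(3), where p = 1 and S = S and b = b and k = k])
    fix i g assume "i < t" "g \<in> G"
    have "e (x, f i x, g x) \<in> {1..n}" if "x < 2 * L" for x
      using e2[OF \<open>i < t\<close> \<open>g \<in> G\<close> that] by simp
    moreover have "1 \<in> {1..n}" using \<open>24 * L * q < n\<close> by simp
    ultimately show "S i g \<subseteq> {1..n}"
      unfolding S_def by blast
  next
    fix i j g h assume *: "i < t" "j < t" "i \<noteq> j" "g \<in> G" "h \<in> G"
    have "S i g \<inter> S j h \<subseteq> insert 1 ((\<lambda>x. e (x, f i x, g x)) ` {x. x < 2 * L \<and> f i x = f j x})"
    proof
      fix v assume v: "v \<in> S i g \<inter> S j h"
      show "v \<in> insert 1 ((\<lambda>x. e (x, f i x, g x)) ` {x. x < 2 * L \<and> f i x = f j x})"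
      proof (cases "v = 1")
        case False
        with v obtain x y where xy: "x < 2 * L" "v = e (x, f i x, g x)" "y < 2 * L" "v = e (y, f j y, h y)"
          by (auto simp: S_def)
        then have "x = y \<and> f i x = f j y"
          using eq[OF _ *(1,2,4,5), of x y] by auto
        with xy show ?thesis by blast
      qed simp
    qed
    then have "card (S i g \<inter> S j h)
        \<le> card (insert 1 ((\<lambda>x. e (x, f i x, g x)) ` {x. x < 2 * L \<and> f i x = f j x}))"
      by (intro card_mono) auto
    \<comment> \<open>The strict bound in \<open>agree\<close> leaves room for the common point
      1.\<close>
    also have "\<dots> \<le> Suc (agreement (2 * L) (f i) (f j))"
      unfolding agreement_def
      by (intro order_trans[OF card_insert_le_m1] card_insert_le_m1) (auto intro!: card_image_le)
    also have "\<dots> \<le> b" using agree[OF *(1-3)] by simp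
    finally show "card (S i g \<inter> S j h) \<le> b" .
  next
    fix i g h assume *: "i < t" "g \<in> G" "h \<in> G" "g \<noteq> h"
    define N where "N = {x. x < 2 * L \<and> g x \<noteq> h x}"
    have "2 * L = card ({x. x < 2 * L \<and> g x = h x} \<union> N)"
      by (subst card_lessThan[symmetric], rule arg_cong[where f = card]) (auto simp: N_def)
    also have "\<dots> = agreement (2 * L) g h + card N"
      unfolding agreement_def by (rule card_Un_disjoint) (auto simp: N_def)
    \<comment> \<open>Fewer than \<open>L\<close> agreements among \<open>2 * L\<close> arguments
      leave more than \<open>L\<close> disagreements.\<close>
    finally have "b * k + 1 \<le> card N"
      using G(4)[OF *(2-4)] \<open>b * k \<le> L\<close> by linarith
    also have "card N = card ((\<lambda>x. e (x, f i x, g x)) ` N)"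
    proof (rule card_image[symmetric], rule inj_onI)
      fix x y assume "x \<in> N" "y \<in> N" "e (x, f i x, g x) = e (y, f i y, g y)"
      then show "x = y"
        using eq[OF _ *(1,1,2,2), of x y] unfolding N_def by blast
    qed
    also have "\<dots> \<le> card (S i g - S i h)"
    proof (rule card_mono)
      show "(\<lambda>x. e (x, f i x, g x)) ` N \<subseteq> S i g - S i h"
      proof (rule image_subsetI)
        fix x assume x: "x \<in> N"
        have "e (x, f i x, g x) \<noteq> e (y, f i y, h y)" if "y < 2 * L" for y
          using eq[OF _ *(1,1,2,3), of x y] x that by (auto simp: N_def)
        moreover have "e (x, f i x, g x) \<noteq> 1"
          using e2[OF *(1,2), of x] x by (auto simp: N_def)
        ultimately show "e (x, f i x, g x) \<in> S i g - S i h"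
          using x by (auto simp: S_def N_def)
      qed
    qed (simp add: S_def)
    finally show "b * k + 1 \<le> card (S i g - S i h)" .
  qed (use \<open>24 * L * q < n\<close> len gap \<open>1 \<le> b\<close> in \<open>simp_all add: S_def\<close>)
  then have "(2::nat) ^ (L * t) < 2 ^ (space A n m + 1)"
    unfolding G(2) power_mult .
  then have "L * t < space A n m + 1"
    by (rule power_less_imp_less_exp[rotated]) simp
  then show ?thesis by (simp add: mult.commute)
qed

section \<open>Choice of parameters\<close>

lemma le_space_of_few_sets:
  fixes \<alpha> :: real
  assumes "estimates_set_cover A \<alpha> n m" "0 \<le> \<alpha>" "2 * \<alpha> < real m" "2 \<le> m"
    and "0 < L" "m \<le> L" "24 * L < n"
  shows "L \<le> space A n m"
  \<comment> \<open>With one position \<open>agree\<close> is vacuous, so \<open>q = 1\<close> and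
    \<open>b = 1\<close> work. Taking \<open>k = m - 2\<close> exhausts the stream and turns
    \<open>gap\<close> into \<open>2 * \<alpha> < m\<close>.\<close>
  using mult_le_space[of A \<alpha> n m 1 L "\<lambda>_ _. 0" 1 1 "m - 2"] assms by simp

text \<open>The \<open>f i\<close> are codewords of length \<open>2 * (b * k)\<close> over
  \<open>12 * k\<close> letters, so \<open>code_exists\<close> provides up to \<open>2 ^ b\<close>
  of them. With \<open>L = b * k\<close> and \<open>q = 12 * k\<close>, the room
  \<open>24 * L * q\<close> becomes \<open>288 * b * k^2\<close>.\<close>

lemma le_space_of_many_sets:
  fixes \<alpha> :: real
  assumes est: "estimates_set_cover A \<alpha> n m" "0 \<le> \<alpha>"
    and "2 * \<alpha> \<le> real k" "0 < k" "0 < b" "t \<le> 2 ^ b" "288 * b * k\<^sup>2 < n" "t + 1 + k \<le> m"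
  shows "t * (b * k) \<le> space A n m"
proof -
  obtain F where F: "F \<subseteq> {..<2 * (b * k)} \<rightarrow>\<^sub>E {..<12 * k}" "card F = t" "finite F"
    "\<And>f g. f \<in> F \<Longrightarrow> g \<in> F \<Longrightarrow> f \<noteq> g \<Longrightarrow> agreement (2 * (b * k)) f g < b"
    using code_exists[of "2 * (b * k)" b "12 * k" t] assms by auto
  obtain f where f: "bij_betw f {0..<t} F"
    using ex_bij_betw_nat_finite[OF F(3)] F(2) by auto
  then have fF: "f i \<in> F" if "i < t" for i
    using that by (auto simp: bij_betw_def)
  show ?thesis
  proof (rule mult_le_space[OF est, where f = f and q = "12 * k" and b = b and k = k])
    fix i x assume "i < t" "x < 2 * (b * k)"
    then show "f i x < 12 * k" using fF F(1) by fastforce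
  next
    fix i j assume "i < t" "j < t" "i \<noteq> j"
    then show "agreement (2 * (b * k)) (f i) (f j) < b"
      using f by (intro F(4) fF) (auto simp: bij_betw_def inj_on_def)
  next
    have "2 * \<alpha> * real b \<le> real k * real b"
      using assms by (intro mult_right_mono) auto
    then show "2 * \<alpha> * real b < real (b * k + 2)" by (simp add: mult.commute)
  qed (use assms in \<open>auto simp: power2_eq_square mult.assoc\<close>)
qed

text \<open>Below \<open>m = 8 * \<alpha>\<close> order \<open>n\<close> bits are enough for the
  claim and one prefix set suffices; above it, half of the stream can serve as prefix.\<close>

lemma space_lower_bound:
  fixes \<alpha> :: real
  assumes est: "estimates_set_cover A \<alpha> n m" and \<alpha>: "1 \<le> \<alpha>" "2 * \<alpha> < real m"
    and small: "10368 * (real r * ln n) * \<alpha>\<^sup>2 \<le> n"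
    and n: "100 \<le> n" "1 \<le> ln (real n)" and r: "0 < r" and m: "real m \<le> real n ^ r"
  shows "real m * real n / (3456 * \<alpha>) \<le> real (space A n m)"
proof -
  have rln: "1 \<le> real r * ln n"
    using mult_mono[of 1 "real r" 1 "ln n"] n r by simp
  have a2: "10368 * \<alpha>\<^sup>2 \<le> n"
    using mult_right_mono[OF rln, of "\<alpha>\<^sup>2"] small by simp
  have a1: "\<alpha> \<le> \<alpha>\<^sup>2"
    using \<alpha>(1) by (simp add: power2_eq_square)
  have m2: "2 < m" using \<alpha> by linarith
  show ?thesis
  proof (cases "real m < 8 * \<alpha>")
    case True
    define L where "L = (n - 1) div 24"
    have L: "24 * L < n" "n \<le> 24 * L + 24"
      using n(1) by (auto simp: L_def)
    then have L32: "real n \<le> 32 * real L"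
      using n(1) by linarith
    have "real m \<le> real L"
      using True a1 a2 L32 by linarith
    then have "L \<le> space A n m"
      using \<alpha> m2 L by (intro le_space_of_few_sets[OF est]) auto
    have "real m * real n \<le> 8 * \<alpha> * (32 * real L)"
      using True L32 \<alpha> by (intro mult_mono) auto
    also have "\<dots> \<le> real (space A n m) * (3456 * \<alpha>)"
      using mult_mono[of "real L" "real (space A n m)" "256 * \<alpha>" "3456 * \<alpha>"] \<open>L \<le> space A n m\<close> \<alpha>
      by (simp add: mult.commute)
    finally show ?thesis
      using \<alpha> by (simp add: divide_le_eq)
  next
    case False
    define k where "k = nat \<lceil>2 * \<alpha>\<rceil>"
    have k: "2 * \<alpha> \<le> real k" "real k < 2 * \<alpha> + 1" "0 < k"
      using \<alpha> unfolding k_def by linarith+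
    then have k3: "real k \<le> 3 * \<alpha>" using \<alpha> by linarith
    then have k2: "(real k)\<^sup>2 \<le> 9 * \<alpha>\<^sup>2"
      using power_mono[OF k3, of 2] by (simp add: power_mult_distrib)
    \<comment> \<open>The largest \<open>b\<close> with \<open>288 * b * k^2 < n\<close>.\<close>
    define b where "b = (n - 1) div (288 * k\<^sup>2)"
    have b_up: "288 * b * k\<^sup>2 < n"
    proof -
      have "b * (288 * k\<^sup>2) \<le> n - 1" unfolding b_def by (rule div_times_less_eq_dividend)
      then show ?thesis using n(1) by (simp add: mult.commute mult.left_commute)
    qed
    have "n - 1 < (b + 1) * (288 * k\<^sup>2)"
      unfolding b_def using k(3) dividend_less_div_times[of "288 * k\<^sup>2" "n - 1"] by simp
    then have "n \<le> (b + 1) * (288 * k\<^sup>2)" by linarith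
    then have n_up: "real n \<le> (real b + 1) * (288 * (real k)\<^sup>2)"
      using of_nat_mono[of n "(b + 1) * (288 * k\<^sup>2)", where 'a = real] by (simp add: algebra_simps)
    \<comment> \<open>The rounding loss \<open>288 * k^2 <= 2592 * \<alpha>^2\<close> is at most
      \<open>n / 4\<close>, which raises 288 to 384.\<close>
    then have b_low: "real n \<le> 384 * real b * (real k)\<^sup>2"
    proof -
      have "real n \<le> 288 * (real b * (real k)\<^sup>2) + 288 * (real k)\<^sup>2"
        using n_up unfolding distrib_right by linarith
      with k2 a2 have "real n \<le> 384 * (real b * (real k)\<^sup>2)" by linarith
      then show ?thesis by simp
    qed
    then have "0 < b" using n(1) by (cases b) auto
    have "10368 * (real r * ln n) * \<alpha>\<^sup>2 \<le> 3456 * real b * \<alpha>\<^sup>2"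
    proof -
      have "384 * real b * (real k)\<^sup>2 \<le> 384 * real b * (9 * \<alpha>\<^sup>2)"
        using k2 by (intro mult_left_mono) auto
      also have "\<dots> = 3456 * real b * \<alpha>\<^sup>2" by simp
      finally show ?thesis using b_low small by linarith
    qed
    then have "3 * (real r * ln n) \<le> real b"
      using \<alpha>(1) by simp
    \<comment> \<open>This is \<open>ln (1 + x) <= x\<close> at \<open>x = -1/2\<close>.\<close>
    moreover have "1 / 2 \<le> ln (2::real)"
      using ln_add_one_self_le_self2[of "-1/2"] by (simp add: ln_div)
    then have "real b * (1 / 2) \<le> real b * ln 2"
      by (rule mult_left_mono) simp
    ultimately have "real r * ln n \<le> real b * ln 2"
      using rln by linarith
    then have "ln (real n ^ r) \<le> ln (2 ^ b)"
      using n(1) by (simp add: ln_realpow)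
    then have "real n ^ r \<le> 2 ^ b"
      using n(1) by simp
    then have "real m \<le> real (2 ^ b)"
      using m unfolding of_nat_power of_nat_numeral by linarith
    then have "m div 2 \<le> 2 ^ b"
      unfolding of_nat_le_iff by linarith
    \<comment> \<open>The remaining half has at least \<open>4 * \<alpha>\<close> sets, while
      \<open>1 + k < 2 * \<alpha> + 2\<close>.\<close>
    moreover have "m div 2 + 1 + k \<le> m"
      using False \<alpha> k by linarith
    ultimately have "m div 2 * (b * k) \<le> space A n m"
      using \<alpha> k \<open>0 < b\<close> b_up by (intro le_space_of_many_sets[OF est]) auto
    then have sp: "real (m div 2) * (real b * real k) \<le> real (space A n m)"
      by (metis of_nat_le_iff of_nat_mult)
    have "real n \<le> (384 * (real b * real k)) * real k"
      using b_low by (simp add: power2_eq_square mult.assoc)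
    also have "\<dots> \<le> (384 * (real b * real k)) * (3 * \<alpha>)"
      using k3 by (intro mult_left_mono) auto
    finally have "real m * real n \<le> (3 * real (m div 2)) * ((384 * (real b * real k)) * (3 * \<alpha>))"
      using m2 by (intro mult_mono) auto
    also have "\<dots> = (3456 * \<alpha>) * (real (m div 2) * (real b * real k))"
      by simp
    also have "\<dots> \<le> (3456 * \<alpha>) * real (space A n m)"
      using sp \<alpha> by (intro mult_left_mono) auto
    finally show ?thesis
      using \<alpha> by (simp add: divide_le_eq mult.commute)
  qed
qed

text \<open>A hypothesis like \<open>m_nondegenerate\<close> excludes the case
  \<open>m <= \<alpha>\<close>, in which the constant answer \<open>m\<close> is a valid
  estimate.\<close>

theorem theorem6p1:
  fixes \<alpha> :: "nat \<Rightarrow> real" and m :: "nat \<Rightarrow> nat" and A :: "nat \<Rightarrow> stream_alg"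
  assumes alpha_ge_1: "\<forall>\<^sub>F n in sequentially. 1 \<le> \<alpha> n"
    and alpha_small: "\<alpha> \<in> o(\<lambda>n. sqrt (real n / ln (real n)))"
    and m_poly: "\<exists>k::nat. (\<lambda>n. real (m n)) \<in> O(\<lambda>n. real n ^ k)"
    and m_nondegenerate: "\<forall>\<^sub>F n in sequentially. 2 * \<alpha> n < real (m n)"
    and estimates: "\<forall>\<^sub>F n in sequentially. estimates_set_cover (A n) (\<alpha> n) n (m n)"
  shows "(\<lambda>n. real (space (A n) n (m n))) \<in> \<Omega>(\<lambda>n. real (m n) * real n / \<alpha> n)"
proof -
  obtain s where "(\<lambda>n. real (m n)) \<in> O(\<lambda>n. real n ^ s)" using m_poly by blast
  then obtain C where C: "\<forall>\<^sub>F n in sequentially. norm (real (m n)) \<le> C * norm (real n ^ s)"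
    by (rule landau_o.bigE)
  \<comment> \<open>The extra power of \<open>n\<close> absorbs the constant \<open>C\<close> once
    \<open>n >= C\<close>.\<close>
  define r where "r = Suc s"
  \<comment> \<open>Chosen so that squaring the bound on \<open>\<alpha>\<close> gives the
    hypothesis \<open>small\<close> of \<open>space_lower_bound\<close>.\<close>
  define c where "c = sqrt (1 / (10368 * real r))"
  have "0 < c" by (simp add: c_def r_def)
  have "\<forall>\<^sub>F n in sequentially. norm (\<alpha> n) \<le> c * norm (sqrt (real n / ln (real n)))"
    by (rule landau_o.smallD[OF alpha_small \<open>0 < c\<close>])
  moreover have "\<forall>\<^sub>F n in sequentially. 100 \<le> n"
    by (rule eventually_ge_at_top)
  moreover have "\<forall>\<^sub>F n in sequentially. C \<le> real n"
    by (rule eventually_compose_filterlim[OF eventually_ge_at_top filterlim_real_sequentially])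
  ultimately have "\<forall>\<^sub>F n in sequentially.
      1 / 3456 * norm (real (m n) * real n / \<alpha> n) \<le> norm (real (space (A n) n (m n)))"
    using alpha_ge_1 m_nondegenerate estimates C
  proof eventually_elim
    case (elim n)
    have "exp 1 \<le> real n" using exp_le elim(2) by linarith
    then have ln1: "1 \<le> ln (real n)"
      using elim(2) by (subst ln_ge_iff) auto
    have "(\<alpha> n)\<^sup>2 \<le> (c * sqrt (real n / ln (real n)))\<^sup>2"
      using elim(1,4) ln1 by (intro power_mono) auto
    also have "\<dots> = real n / (10368 * (real r * ln n))"
      using ln1 by (simp add: c_def power_mult_distrib real_sqrt_divide power_divide)
    finally have "10368 * (real r * ln n) * (\<alpha> n)\<^sup>2 \<le> n"
      using ln1 by (subst (asm) pos_le_divide_eq) (auto simp: r_def mult.commute)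
    moreover have "real (m n) \<le> real n ^ r"
    proof -
      have "real (m n) \<le> C * real n ^ s" using elim(7) by simp
      also have "\<dots> \<le> real n * real n ^ s"
        using elim(3) by (intro mult_right_mono) auto
      finally show ?thesis by (simp add: r_def)
    qed
    ultimately have "real (m n) * real n / (3456 * \<alpha> n) \<le> real (space (A n) n (m n))"
      using elim ln1 by (intro space_lower_bound[where r = r]) (auto simp: r_def)
    then show ?case using elim(4) by simp
  qed
  then show ?thesis
    by (intro landau_omega.bigI[of "1 / 3456"]) auto
qed

end
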